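(* For every predicate $P$, $$\mathbf{R1}(\mathbf{R2}_c(P)) = \big(\exists t \in \mathcal{T}.\ P[\langle\rangle, t / tr, tr'] \land tr' = tr \frown t\big).$$
   Context: Fix a trace algebra $(\mathcal{T}, \frown, \langle\rangle)$: a set with associative $\frown$, two-sided unit $\langle\rangle$, left and right cancellation, and $x \frown y = \langle\rangle \Rightarrow x = \langle\rangle$. Prefix: $x \le y \iff \exists z.\ y = x \frown z$; subtraction: $y - x$ is the unique $z$ with $y = x \frown z$ if $x \le y$, else $\langle\rangle$. Predicates are relations (formulas identified up to logical equivalence) over unprimed and primed variables, including $tr, tr' : \mathcal{T}$ (and possibly $wait, wait'$ and other state variables); $t$ is a fresh variable. Conditional: $P \lhd b \rhd Q \triangleq (b \land P) \lor (\lnot b \land Q)$. $\mathbf{R1}(P) \triangleq P \land tr \le tr'$; $\mathbf{R2}_c(P) \triangleq P[\langle\rangle, tr' - tr / tr, tr'] \lhd tr \le tr' \rhd P$ (simultaneous substitution). *)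

theory Defs
  imports Main
begin

text \<open>
  Trace algebras, with concatenation written \<open>+\<close> and the empty trace written \<open>0\<close>.
  The superclasses supply associativity, both unit laws and both cancellation laws;
  \<open>+\<close> need not be commutative.
\<close>

class trace_algebra = cancel_semigroup_add + monoid_add +
  assumes add_eq_zero_left: "x + y = 0 \<Longrightarrow> x = 0"

definition trace_prefix :: "'t::trace_algebra \<Rightarrow> 't \<Rightarrow> bool" (infix "\<le>\<^sub>t" 50) where
  "x \<le>\<^sub>t y \<longleftrightarrow> (\<exists>z. y = x + z)"

definition trace_minus :: "'t::trace_algebra \<Rightarrow> 't \<Rightarrow> 't" (infixl "-\<^sub>t" 65) where
  "y -\<^sub>t x = (if x \<le>\<^sub>t y then THE z. y = x + z else 0)"

text \<open>Subtraction is well defined: the witness of a prefix is unique.\<close>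

lemma trace_prefix_unique: "x \<le>\<^sub>t y \<Longrightarrow> \<exists>!z. y = x + z"
  for x y :: "'t::trace_algebra"
  by (auto simp: trace_prefix_def)

text \<open>
  An observation assigns values to all variables. All variables other than the trace
  (\<open>wait\<close> and any further state variables) live in the record extension.
\<close>

record 't obs =
  tr :: 't

text \<open>
  A predicate is a relation between an observation \<open>s\<close> of the unprimed variables and an
  observation \<open>s'\<close> of the primed variables, so \<open>tr'\<close> is \<open>tr s'\<close>. An expression is likewise
  a function of \<open>s\<close> and \<open>s'\<close>. Equality of predicates is thus logical equivalence. The
  non-trace variables before and after may range over different types.
\<close>

type_synonym ('a, 't, 'r, 's) expr =
  "('t, 'r) obs_scheme \<Rightarrow> ('t, 's) obs_scheme \<Rightarrow> 'a"

type_synonym ('t, 'r, 's) rpred = "(bool, 't, 'r, 's) expr"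

text \<open>Simultaneous substitution \<open>P[e, f / tr, tr']\<close>.\<close>

definition subst_tr ::
  "('t, 'r, 's) rpred \<Rightarrow> ('t, 't, 'r, 's) expr \<Rightarrow> ('t, 't, 'r, 's) expr
    \<Rightarrow> ('t, 'r, 's) rpred" where
  "subst_tr P e f = (\<lambda>s s'. P (s\<lparr>tr := e s s'\<rparr>) (s'\<lparr>tr := f s s'\<rparr>))"

definition cond ::
  "('t, 'r, 's) rpred \<Rightarrow> ('t, 'r, 's) rpred \<Rightarrow> ('t, 'r, 's) rpred \<Rightarrow> ('t, 'r, 's) rpred"
  ("(_ \<lhd> _ \<rhd> _)" [52, 0, 53] 52) where
  "P \<lhd> b \<rhd> Q = (\<lambda>s s'. (b s s' \<and> P s s') \<or> (\<not> b s s' \<and> Q s s'))"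

definition R1 :: "('t::trace_algebra, 'r, 's) rpred \<Rightarrow> ('t, 'r, 's) rpred" where
  "R1 P = (\<lambda>s s'. P s s' \<and> tr s \<le>\<^sub>t tr s')"

definition R2c :: "('t::trace_algebra, 'r, 's) rpred \<Rightarrow> ('t, 'r, 's) rpred" where
  "R2c P = subst_tr P (\<lambda>s s'. 0) (\<lambda>s s'. tr s' -\<^sub>t tr s) \<lhd> (\<lambda>s s'. tr s \<le>\<^sub>t tr s') \<rhd> P"

end

theory Submission
  imports Defs
begin

text \<open>Under \<open>R1\<close> the guard of \<open>R2c\<close> is true, so only its substituted
  branch survives. A prefix is the same thing as a decomposition \<open>tr s' = tr s + t\<close>,
  and by left cancellation this \<open>t\<close> is exactly the difference
  \<open>tr s' -\<^sub>t tr s\<close>. Naming the difference turns one side into the other.\<close>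

lemma trace_prefix_append: "x \<le>\<^sub>t x + z"
  by (auto simp: trace_prefix_def)

text \<open>Left cancellation makes \<open>z\<close> the only candidate for the description in
  \<open>trace_minus\<close>.\<close>

lemma trace_minus_append: "(x + z) -\<^sub>t x = z"
  by (simp add: trace_minus_def trace_prefix_append)

theorem theorem10:
  fixes P :: "('t::trace_algebra, 'r, 's) rpred"
  shows "R1 (R2c P) =
    (\<lambda>s s'. \<exists>t::'t. subst_tr P (\<lambda>_ _. 0) (\<lambda>_ _. t) s s' \<and> tr s' = tr s + t)"
proof (intro ext iffI)
  fix s :: "('t, 'r) obs_scheme" and s' :: "('t, 's) obs_scheme"
  assume R: "R1 (R2c P) s s'"
  then obtain t where t: "tr s' = tr s + t"
    by (auto simp: R1_def trace_prefix_def)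
  with R have "subst_tr P (\<lambda>_ _. 0) (\<lambda>_ _. t) s s'"
    by (simp add: R1_def R2c_def cond_def subst_tr_def trace_prefix_append trace_minus_append)
  with t show "\<exists>t. subst_tr P (\<lambda>_ _. 0) (\<lambda>_ _. t) s s' \<and> tr s' = tr s + t"
    by blast
next
  fix s :: "('t, 'r) obs_scheme" and s' :: "('t, 's) obs_scheme"
  assume "\<exists>t. subst_tr P (\<lambda>_ _. 0) (\<lambda>_ _. t) s s' \<and> tr s' = tr s + t"
  \<comment> \<open>The equation for \<open>tr s'\<close> yields both the \<open>R1\<close> conjunct
    and the guard of the conditional.\<close>
  then show "R1 (R2c P) s s'"
    by (auto simp: R1_def R2c_def cond_def subst_tr_def trace_prefix_append trace_minus_append)
qed

end
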